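(* Let $k\ge 2$ be an integer and let $G=(V(G),E(G),w)$ be a finite weighted graph with $w:E(G)\to\mathbb{R}_{\ge 0}$ and order $n\ge k$. Then $G$ admits a $k$-partition $(X_1,\dots,X_k)$ of $V(G)$ into $k$ non-empty parts such that $$\max\{w(G[X_i]) : i\in[k]\}\le \frac{w(G)}{k^2}+\frac{k-1}{2k^2}\Delta_w(G).$$
   Context: For a weighted graph $G$, $w(G)$ is the total weight of its edges and $w(G[S])$ is the total weight of edges with both endpoints in $S\subseteq V(G)$. The weighted degree of a vertex $v$ is $w(v)=\sum_{u\in N(v)}w(vu)$, and $\Delta_w(G)=\max_v w(v)$ is the maximum weighted degree. *)

theory Defs
  imports Complex_Main "HOL-Library.Disjoint_Sets"
begin

text \<open>
  Graphs are simple and undirected: an edge is a two-element set of vertices.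
  The values of \<open>w\<close> outside \<open>E\<close> are irrelevant.
\<close>

locale finite_weighted_graph =
  fixes V :: "'a set" and E :: "'a set set" and w :: "'a set \<Rightarrow> real"
  assumes finite_vertices: "finite V"
    and edges: "\<And>e. e \<in> E \<Longrightarrow> e \<subseteq> V \<and> card e = 2"
    and weight_nonneg: "\<And>e. e \<in> E \<Longrightarrow> 0 \<le> w e"

definition total_weight :: "'a set set \<Rightarrow> ('a set \<Rightarrow> real) \<Rightarrow> real" where
  "total_weight E w = (\<Sum>e\<in>E. w e)"

definition induced_edges :: "'a set set \<Rightarrow> 'a set \<Rightarrow> 'a set set" where
  "induced_edges E S = {e \<in> E. e \<subseteq> S}"

definition neighborhood :: "'a set set \<Rightarrow> 'a \<Rightarrow> 'a set" where
  "neighborhood E v = {u. {v, u} \<in> E}"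

definition weighted_degree :: "'a set set \<Rightarrow> ('a set \<Rightarrow> real) \<Rightarrow> 'a \<Rightarrow> real" where
  "weighted_degree E w v = (\<Sum>u\<in>neighborhood E v. w {v, u})"

definition max_weighted_degree :: "'a set \<Rightarrow> 'a set set \<Rightarrow> ('a set \<Rightarrow> real) \<Rightarrow> real" where
  "max_weighted_degree V E w = Max (weighted_degree E w ` V)"

definition is_k_partition :: "nat \<Rightarrow> 'a set \<Rightarrow> (nat \<Rightarrow> 'a set) \<Rightarrow> bool" where
  "is_k_partition k V X \<longleftrightarrow>
     (\<Union>i\<in>{1..k}. X i) = V \<and> disjoint_family_on X {1..k} \<and> (\<forall>i\<in>{1..k}. X i \<noteq> {})"

end

theory Submission
  imports Defs
begin

text \<open>
  Put $B = w(G)/k^2 + (k-1)\Delta/(2k^2)$. We split off a single part $S$ with $w(S) \le B$ whose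
  complement $Y$ has smaller maximum degree $\Delta'$ and satisfies
  $w(Y) + (k-2)\Delta'/2 \le (k-1)^2 B$, so that induction on $k$ applies to $Y$ with the same $B$.
  A minimizer $S_0$ of $(k-1) w(S) + w(V - S)$ is stable: moving one vertex across does not pay.
  If $w(S_0) \le B$, vertices are added while they fit; this keeps the vertices of $Y$ stable, which
  bounds $w(Y)$ by the cut and the degrees in $Y$ by $(1 - 1/k)\Delta$.
  If $w(S_0) > B$, vertices are removed until the set just fits; this keeps the remaining vertices of
  the set stable, so the cut is large. The gap $\delta = B - w(S)$ lowers the degrees
  in $Y$, because a vertex that does not fit into $S$ sends weight more than $\delta$ there.
\<close>

section \<open>Degrees, volumes and cuts of a symmetric weight\<close>

locale symmetric_weight =
  fixes g :: "'a \<Rightarrow> 'a \<Rightarrow> real"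
  assumes sym: "g u v = g v u" and diag: "g v v = 0" and nonneg: "0 \<le> g u v"
begin

text \<open>Membership of \<open>v\<close> in \<open>S\<close> is left free; the zero diagonal makes
  it irrelevant, so one function measures degrees inside a part and across to another part.\<close>

definition deg :: "'a set \<Rightarrow> 'a \<Rightarrow> real" where
  "deg S v = (\<Sum>u\<in>S. g v u)"

text \<open>Sums over ordered pairs, so \<open>vol S\<close> is twice the weight inside \<open>S\<close>;
  accordingly the bound \<open>b\<close> below is \<open>2B\<close>.\<close>

definition vol :: "'a set \<Rightarrow> real" where
  "vol S = (\<Sum>v\<in>S. deg S v)"

lemma deg_nonneg: "0 \<le> deg S v"
  by (simp add: deg_def nonneg sum_nonneg)

lemma vol_nonneg: "0 \<le> vol S"
  by (simp add: vol_def deg_nonneg sum_nonneg)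

lemma vol_empty [simp]: "vol {} = 0"
  by (simp add: vol_def)

lemma deg_insert: "finite S \<Longrightarrow> x \<notin> S \<Longrightarrow> deg (insert x S) v = deg S v + g v x"
  by (simp add: deg_def)

lemma deg_mono: "finite T \<Longrightarrow> S \<subseteq> T \<Longrightarrow> deg S v \<le> deg T v"
  unfolding deg_def by (rule sum_mono2) (auto simp: nonneg)

lemma deg_split: "finite V \<Longrightarrow> S \<subseteq> V \<Longrightarrow> deg V v = deg S v + deg (V - S) v"
  unfolding deg_def by (metis add.commute sum.subset_diff)

lemma vol_insert:
  assumes "finite S" "x \<notin> S"
  shows "vol (insert x S) = vol S + 2 * deg S x"
proof -
  have "vol (insert x S) = deg (insert x S) x + (\<Sum>v\<in>S. deg (insert x S) v)"
    using assms by (simp add: vol_def)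
  also have "\<dots> = deg S x + (\<Sum>v\<in>S. deg S v + g v x)"
    using assms by (simp add: deg_insert diag)
  also have "(\<Sum>v\<in>S. deg S v + g v x) = vol S + deg S x"
    by (simp add: sum.distrib vol_def deg_def[of S x] sym[of _ x])
  finally show ?thesis by simp
qed

lemma deg_remove: "finite S \<Longrightarrow> deg (S - {x}) x = deg S x"
  by (cases "x \<in> S") (auto simp: deg_def sum.remove[of S x] diag)

lemma vol_remove:
  assumes "finite S" "x \<in> S"
  shows "vol S = vol (S - {x}) + 2 * deg S x"
  using vol_insert[of "S - {x}" x] assms by (simp add: deg_remove insert_absorb)

lemma vol_mono: 
  assumes "finite T" "S \<subseteq> T"
  shows "vol S \<le> vol T"
proof -
  have "vol S \<le> (\<Sum>v\<in>S. deg T v)"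
    unfolding vol_def using assms by (intro sum_mono deg_mono)
  also have "\<dots> \<le> vol T"
    unfolding vol_def using assms by (intro sum_mono2) (auto simp: deg_nonneg)
  finally show ?thesis .
qed

definition cut :: "'a set \<Rightarrow> 'a set \<Rightarrow> real" where
  "cut S T = (\<Sum>v\<in>S. deg T v)"

lemma cut_sym: "cut S T = cut T S"
  unfolding cut_def deg_def by (subst sum.swap) (simp add: sym)

lemma vol_split:
  assumes "finite V" "S \<subseteq> V"
  shows "vol V = vol S + 2 * cut S (V - S) + vol (V - S)"
proof -
  have "vol V = (\<Sum>v\<in>S. deg V v) + (\<Sum>v\<in>V - S. deg V v)"
    unfolding vol_def using assms by (metis add.commute sum.subset_diff)
  also have "(\<Sum>v\<in>S. deg V v) = vol S + cut S (V - S)"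
    using assms by (simp add: deg_split[of V S] sum.distrib vol_def cut_def)
  also have "(\<Sum>v\<in>V - S. deg V v) = cut (V - S) S + vol (V - S)"
    using assms by (simp add: deg_split[of V S] sum.distrib vol_def cut_def)
  finally show ?thesis by (simp add: cut_sym[of "V - S"])
qed

section \<open>Extremal vertex sets\<close>

text \<open>Moving \<open>v\<close> out of \<open>S\<close> changes
  \<open>c * vol S + vol (V - S)\<close> by \<open>2 * (deg (V - S) v - c * deg S v)\<close>, and
  moving it in changes it by the negative of that expression; at a minimizer no move decreases the
  value.\<close>

lemma locally_optimal_set_exists:
  fixes c :: real
  assumes fin: "finite V"
  obtains S where "S \<subseteq> V"
    "\<And>v. v \<in> S \<Longrightarrow> c * deg S v \<le> deg (V - S) v"
    "\<And>v. v \<in> V - S \<Longrightarrow> deg (V - S) v \<le> c * deg S v"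
proof -
  define \<phi> where "\<phi> S = c * vol S + vol (V - S)" for S
  obtain S where S: "S \<in> Pow V" "\<And>T. T \<in> Pow V \<Longrightarrow> \<phi> S \<le> \<phi> T"
    using ex_is_arg_min_if_finite[of "Pow V" \<phi>] fin
    by (auto simp: is_arg_min_linorder)
  have finS: "finite S" using S fin finite_subset by blast
  show thesis
  proof (rule that)
    show "S \<subseteq> V" using S by simp
    fix v assume v: "v \<in> S"
    have "V - (S - {v}) = insert v (V - S)" using v S by auto
    hence "vol (V - (S - {v})) = vol (V - S) + 2 * deg (V - S) v"
      using vol_insert[of "V - S" v] fin v by simp
    moreover have "vol S = vol (S - {v}) + 2 * deg S v" using vol_remove finS v by blast
    moreover have "\<phi> S \<le> \<phi> (S - {v})" using S(1) by (intro S(2)) auto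
    ultimately show "c * deg S v \<le> deg (V - S) v" by (simp add: \<phi>_def algebra_simps)
  next
    fix v assume v: "v \<in> V - S"
    have "vol (insert v S) = vol S + 2 * deg S v" using vol_insert finS v by blast
    moreover have "V - insert v S = V - S - {v}" by auto
    hence "vol (V - S) = vol (V - insert v S) + 2 * deg (V - S) v"
      using vol_remove[of "V - S" v] fin v by simp
    moreover have "\<phi> S \<le> \<phi> (insert v S)" using S(1) v by (intro S(2)) auto
    ultimately show "deg (V - S) v \<le> c * deg S v" by (simp add: \<phi>_def algebra_simps)
  qed
qed

lemma maximal_superset_exists:
  assumes "finite V" "S \<subseteq> V" "P S"
  obtains T where "S \<subseteq> T" "T \<subseteq> V" "P T" "\<And>v. v \<in> V - T \<Longrightarrow> \<not> P (insert v T)"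
proof -
  define A where "A = {T. S \<subseteq> T \<and> T \<subseteq> V \<and> P T}"
  have "finite A" using assms by (auto simp: A_def intro: finite_subset[of _ "Pow V"])
  moreover have "S \<in> A" using assms by (simp add: A_def)
  ultimately obtain T where T: "T \<in> A" "\<forall>U\<in>A. T \<subseteq> U \<longrightarrow> T = U"
    using finite_has_maximal2 by meson
  show thesis
  proof (rule that)
    show "S \<subseteq> T" "T \<subseteq> V" "P T" using T(1) by (simp_all add: A_def)
    fix v assume v: "v \<in> V - T"
    show "\<not> P (insert v T)"
    proof
      assume "P (insert v T)"
      hence "insert v T \<in> A" using T(1) v by (auto simp: A_def)
      thus False using T(2) v by blast
    qed
  qed
qed

lemma minimal_heavy_subset_exists:
  assumes "finite S" "vol S > b"
  obtains Z where "Z \<subseteq> S" "vol Z > b" "\<And>v. v \<in> Z \<Longrightarrow> vol (Z - {v}) \<le> b"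
proof -
  define A where "A = {T. T \<subseteq> S \<and> vol T > b}"
  have "finite A" using assms by (auto simp: A_def intro: finite_subset[of _ "Pow S"])
  moreover have "S \<in> A" using assms by (simp add: A_def)
  ultimately obtain Z where Z: "Z \<in> A" "\<forall>U\<in>A. U \<subseteq> Z \<longrightarrow> Z = U"
    using finite_has_minimal2 by meson
  show thesis
  proof (rule that)
    show "Z \<subseteq> S" "vol Z > b" using Z(1) by (simp_all add: A_def)
    fix v assume v: "v \<in> Z"
    show "vol (Z - {v}) \<le> b"
    proof (rule ccontr)
      assume "\<not> vol (Z - {v}) \<le> b"
      hence "Z - {v} \<in> A" using Z(1) by (auto simp: A_def)
      thus False using Z(2) v by blast
    qed
  qed
qed

section \<open>Splitting off one part\<close>

text \<open>Enlarging \<open>S0\<close> raises degrees into the part and lowers those in the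
  complement, so outer stability survives until no vertex fits. A small remaining gap lets stability
  alone bound the degrees; with a large gap, fullness gives the better bound.\<close>

lemma split_off_from_light_set:
  fixes K D b :: real
  assumes K: "K \<ge> 2" and fin: "finite V" and D: "0 \<le> D" "\<And>v. v \<in> V \<Longrightarrow> deg V v \<le> D"
    and small: "vol V + (K - 1) * D \<le> K\<^sup>2 * b"
    and S0: "S0 \<subseteq> V" "vol S0 \<le> b"
    and stable: "\<And>v. v \<in> V - S0 \<Longrightarrow> deg (V - S0) v \<le> (K - 1) * deg S0 v"
  shows "\<exists>S D'. S \<subseteq> V \<and> vol S \<le> b \<and> 0 \<le> D' \<and> (\<forall>v\<in>V - S. deg (V - S) v \<le> D') \<and>
    vol (V - S) + (K - 2) * D' \<le> (K - 1)\<^sup>2 * b"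
proof -
  obtain S where S: "S0 \<subseteq> S" "S \<subseteq> V" "vol S \<le> b"
      and full: "\<And>v. v \<in> V - S \<Longrightarrow> \<not> vol (insert v S) \<le> b"
    using maximal_superset_exists[of V S0 "\<lambda>T. vol T \<le> b"] fin S0 by blast
  define Y where "Y = V - S"
  have finS: "finite S" and finY: "finite Y" using S fin finite_subset by (auto simp: Y_def)
  have stableY: "deg Y v \<le> (K - 1) * deg S v" if v: "v \<in> Y" for v
  proof -
    have "deg Y v \<le> deg (V - S0) v" using fin S by (intro deg_mono) (auto simp: Y_def)
    also have "\<dots> \<le> (K - 1) * deg S0 v" using stable v S by (auto simp: Y_def)
    also have "\<dots> \<le> (K - 1) * deg S v" using K finS S by (intro mult_left_mono deg_mono) auto
    finally show ?thesis .
  qed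
  have degY: "deg S v + deg Y v \<le> D" if "v \<in> Y" for v
    using D(2)[of v] deg_split[of V S v] fin S that by (simp add: Y_def)
  have total: "vol V = vol S + 2 * cut Y S + vol Y"
    using vol_split[OF fin S(2)] cut_sym[of S Y] by (simp add: Y_def)
  \<comment> \<open>Halved because inserting \<open>v\<close> raises \<open>vol S\<close> by
    \<open>2 * deg S v\<close>: \<open>v\<close> fits exactly if
    \<open>deg S v \<le> \<delta>\<close>.\<close>
  define \<delta> where "\<delta> = (b - vol S) / 2"
  have volS: "vol S = b - 2 * \<delta>" by (simp add: \<delta>_def field_simps)
  show ?thesis
  \<comment> \<open>At the threshold \<open>\<delta> = D / K\<close> the two choices of
    \<open>D'\<close> below coincide.\<close>
  proof (cases "K * \<delta> \<le> D")
    case True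
    define D' where "D' = (K - 1) * (D / K)"
    have "deg Y v \<le> D'" if v: "v \<in> Y" for v
    proof -
      have "K * deg Y v \<le> (K - 1) * deg S v + (K - 1) * deg Y v"
        using stableY[OF v] by (simp add: algebra_simps)
      also have "\<dots> \<le> (K - 1) * D"
        using degY[OF v] K by (simp add: mult_left_mono flip: distrib_left)
      finally show ?thesis using K by (simp add: D'_def field_simps)
    qed
    moreover have "vol Y + (K - 2) * D' \<le> (K - 1)\<^sup>2 * b"
    proof -
      have "vol Y \<le> (K - 1) * cut Y S"
        unfolding vol_def cut_def sum_distrib_left using stableY by (rule sum_mono)
      \<comment> \<open>The cut is eliminated: \<open>vol V - vol S\<close> equals
        \<open>2 * cut Y S + vol Y\<close>, and \<open>(K - 1) * cut Y S\<close> is at least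
        \<open>vol Y\<close>.\<close>
      hence "(K + 1) * vol Y \<le> (K - 1) * (vol V - vol S)"
        using total by (simp add: algebra_simps)
      also have "\<dots> \<le> (K - 1) * (K\<^sup>2 * b - (K - 1) * D - b + 2 * \<delta>)"
        using small volS K by (intro mult_left_mono) auto
      also have "\<dots> \<le> (K - 1) * (K\<^sup>2 * b - (K - 1) * D - b + 2 * (D / K))"
        using True K by (intro mult_left_mono add_left_mono) (auto simp: field_simps)
      also have "\<dots> = (K + 1) * ((K - 1)\<^sup>2 * b - (K - 2) * D')"
        using K by (simp add: D'_def field_simps power2_eq_square)
      finally show ?thesis using K by simp
    qed
    moreover have "0 \<le> D'" using K D by (simp add: D'_def)
    ultimately show ?thesis using S unfolding Y_def by blast
  next
    case False
    have fullY: "\<delta> < deg S v" if "v \<in> Y" for v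
      using full[of v] vol_insert[of S v] finS that by (auto simp: \<delta>_def Y_def)
    show ?thesis
    \<comment> \<open>Empty \<open>Y\<close> is separate: below, a vertex of \<open>Y\<close> yields
      both the nonnegativity of \<open>D - \<delta>\<close> and the gain in the volume
      estimate.\<close>
    proof (cases "Y = {}")
      case True
      have "0 \<le> K\<^sup>2 * b" using small vol_nonneg[of V] K D(1)
        by (smt (verit) mult_nonneg_nonneg)
      hence "0 \<le> b" using K by (simp add: zero_le_mult_iff)
      thus ?thesis using S True unfolding Y_def by (intro exI[of _ S] exI[of _ 0]) auto
    next
      case False
      then obtain y where y: "y \<in> Y" by blast
      define D' where "D' = D - \<delta>"
      have degD': "deg Y v \<le> D'" if "v \<in> Y" for v
        using degY[OF that] fullY[OF that] by (simp add: D'_def)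
      have "0 \<le> D'" using degD'[OF y] deg_nonneg[of Y y] by linarith
      moreover have "vol Y + (K - 2) * D' \<le> (K - 1)\<^sup>2 * b"
      proof -
        \<comment> \<open>Stability makes every summand nonnegative, so the slack of
          \<open>y\<close> alone bounds the sum from below. Without this gain the final remainder
          would be \<open>(K - 3) * (D - K * \<delta>)\<close>, which has the wrong sign at
          \<open>K = 2\<close>.\<close>
        have "K * \<delta> - D \<le> (K - 1) * deg S y - deg Y y"
        proof -
          have "K * \<delta> \<le> K * deg S y" using fullY[OF y] K by simp
          thus ?thesis using degY[OF y] by (simp add: algebra_simps)
        qed
        also have "\<dots> \<le> (\<Sum>v\<in>Y. (K - 1) * deg S v - deg Y v)"
          using stableY finY y by (intro member_le_sum) auto
        also have "\<dots> = (K - 1) * cut Y S - vol Y"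
          by (simp add: sum_subtractf vol_def cut_def sum_distrib_left)
        finally have "(K + 1) * vol Y \<le> (K - 1) * (vol V - vol S) - 2 * (K * \<delta> - D)"
          using total by (simp add: algebra_simps)
        moreover have "(K - 1) * (vol V - vol S)
            \<le> (K - 1) * (K\<^sup>2 * b - (K - 1) * D - b + 2 * \<delta>)"
          using small volS K by (intro mult_left_mono) auto
        ultimately have "(K + 1) * (vol Y + (K - 2) * D')
            \<le> (K + 1) * ((K - 1)\<^sup>2 * b) + (K - 1) * (D - K * \<delta>)"
          by (simp add: D'_def algebra_simps power2_eq_square)
        also have "\<dots> \<le> (K + 1) * ((K - 1)\<^sup>2 * b)"
          using \<open>\<not> K * \<delta> \<le> D\<close> K by (simp add: mult_le_0_iff)
        finally show ?thesis using K by simp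
      qed
      ultimately show ?thesis using S degD' unfolding Y_def by blast
    qed
  qed
qed

text \<open>Shrinking \<open>S0\<close> preserves inner stability, so a minimal heavy
  \<open>Z\<close> still has a large cut. Dropping one vertex \<open>a\<close> makes it fit and
  meets the volume target with \<open>D' = D - \<delta>\<close>; the degree bound is then obtained
  by enlarging the set as far as that target permits.\<close>

lemma split_off_from_heavy_set:
  fixes K D b :: real
  assumes K: "K \<ge> 2" and fin: "finite V" and D: "0 \<le> D" "\<And>v. v \<in> V \<Longrightarrow> deg V v \<le> D"
    and small: "vol V + (K - 1) * D \<le> K\<^sup>2 * b" and b: "0 \<le> b"
    and S0: "S0 \<subseteq> V" "vol S0 > b"
    and stable: "\<And>v. v \<in> S0 \<Longrightarrow> (K - 1) * deg S0 v \<le> deg (V - S0) v"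
  shows "\<exists>S D'. S \<subseteq> V \<and> vol S \<le> b \<and> 0 \<le> D' \<and> (\<forall>v\<in>V - S. deg (V - S) v \<le> D') \<and>
    vol (V - S) + (K - 2) * D' \<le> (K - 1)\<^sup>2 * b"
proof -
  have finS0: "finite S0" using S0 fin finite_subset by blast
  obtain Z where Z: "Z \<subseteq> S0" "vol Z > b" and light: "\<And>v. v \<in> Z \<Longrightarrow> vol (Z - {v}) \<le> b"
    using minimal_heavy_subset_exists[OF finS0 S0(2)] by blast
  have finZ: "finite Z" and ZV: "Z \<subseteq> V" using Z S0 finS0 finite_subset by auto
  have stableZ: "(K - 1) * deg Z v \<le> deg (V - Z) v" if v: "v \<in> Z" for v
  proof -
    have "(K - 1) * deg Z v \<le> (K - 1) * deg S0 v"
      using K finS0 Z by (intro mult_left_mono deg_mono) auto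
    also have "\<dots> \<le> deg (V - S0) v" using stable v Z by auto
    also have "\<dots> \<le> deg (V - Z) v" using fin Z by (intro deg_mono) auto
    finally show ?thesis .
  qed
  obtain a where a: "a \<in> Z" using Z(2) b by (metis all_not_in_conv not_less vol_empty)
  define z where "z = deg Z a"
  have Kz: "K * z \<le> D"
    using stableZ[OF a] D(2)[of a] deg_split[OF fin ZV, of a] a ZV
    by (auto simp: z_def algebra_simps)
  define \<delta> where "\<delta> S = (b - vol S) / 2" for S
  \<comment> \<open>The volume half of the conclusion for \<open>D' = D - \<delta> S\<close>; the
    degree half is left to maximality.\<close>
  define good where
    "good S \<longleftrightarrow> vol S \<le> b \<and> vol (V - S) + (K - 2) * (D - \<delta> S) \<le> (K - 1)\<^sup>2 * b" for S
  have volZ: "vol Z = vol (Z - {a}) + 2 * z" using vol_remove[OF finZ a] by (simp add: z_def)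
  have \<delta>z: "\<delta> (Z - {a}) \<le> z" using Z(2) volZ by (simp add: \<delta>_def)
  have "good (Z - {a})"
  proof -
    \<comment> \<open>Only the summand of \<open>a\<close> is kept: its \<open>deg (V - Z) a\<close>
      cancels the weight that \<open>a\<close> brings along when it joins the complement.\<close>
    have "deg (V - Z) a - (K - 1) * z \<le> (\<Sum>v\<in>Z. deg (V - Z) v - (K - 1) * deg Z v)"
      unfolding z_def using stableZ finZ a
      by (intro member_le_sum[of a Z "\<lambda>v. deg (V - Z) v - (K - 1) * deg Z v"]) auto
    also have "\<dots> = cut Z (V - Z) - (K - 1) * vol Z"
      by (simp add: sum_subtractf vol_def cut_def sum_distrib_left)
    finally have cutZ: "deg (V - Z) a - (K - 1) * z \<le> cut Z (V - Z) - (K - 1) * vol Z" .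
    have "V - (Z - {a}) = insert a (V - Z)" using a ZV by auto
    hence "vol (V - (Z - {a})) = vol (V - Z) + 2 * deg (V - Z) a"
      using vol_insert[of "V - Z" a] fin a by simp
    also have "\<dots> \<le> vol V - (2 * K - 1) * vol Z + 2 * (K - 1) * z"
      using cutZ vol_split[OF fin ZV] by (simp add: algebra_simps)
    finally have *: "vol (V - (Z - {a})) \<le> vol V - (2 * K - 1) * vol Z + 2 * (K - 1) * z" .
    define d where "d = \<delta> (Z - {a})"
    have vZ: "vol Z = b - 2 * d + 2 * z" using volZ by (simp add: d_def \<delta>_def field_simps)
    have "vol (V - (Z - {a})) + (K - 2) * (D - d)
        \<le> K\<^sup>2 * b - (K - 1) * D - (2 * K - 1) * (b - 2 * d + 2 * z) + 2 * (K - 1) * z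
          + (K - 2) * (D - d)"
      using * small vZ by simp
    also have "\<dots> = (K - 1)\<^sup>2 * b - D + 3 * (K * d) - 2 * (K * z)"
      by (simp add: algebra_simps power2_eq_square)
    also have "\<dots> \<le> (K - 1)\<^sup>2 * b"
    proof -
      have "K * d \<le> K * z" using \<delta>z K by (simp add: d_def)
      thus ?thesis using Kz by linarith
    qed
    finally show ?thesis using light[OF a] by (simp add: good_def d_def)
  qed
  txt \<open>By maximality, a vertex outside \<open>S\<close> either does not fit into \<open>S\<close> or has low degree outside
    \<open>S\<close>, since otherwise adding it would preserve \<open>good\<close>.\<close>
  then obtain S where S: "Z - {a} \<subseteq> S" "S \<subseteq> V" "good S"
      and max: "\<And>v. v \<in> V - S \<Longrightarrow> \<not> good (insert v S)"
    using maximal_superset_exists[of V "Z - {a}" good] fin ZV by blast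
  have finS: "finite S" using S fin finite_subset by blast
  \<comment> \<open>Growing the set only shrinks the gap, so
    \<open>\<delta> S \<le> z \<le> D / K\<close> persists.\<close>
  have "vol (Z - {a}) \<le> vol S" using vol_mono finS S by blast
  hence "\<delta> S \<le> z" using \<delta>z by (simp add: \<delta>_def)
  hence K\<delta>: "K * \<delta> S \<le> D" using Kz K by (smt (verit) mult_left_mono)
  have \<delta>0: "0 \<le> \<delta> S" using S by (simp add: good_def \<delta>_def)
  have "\<delta> S \<le> K * \<delta> S" using \<delta>0 K by (simp add: mult_le_cancel_right1)
  hence "0 \<le> D - \<delta> S" using K\<delta> by simp
  moreover have "deg (V - S) v \<le> D - \<delta> S" if v: "v \<in> V - S" for v
  proof -
    have degV: "deg S v + deg (V - S) v \<le> D"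
      using D(2)[of v] deg_split[of V S v] fin S that by auto
    have volS': "vol (insert v S) = vol S + 2 * deg S v" using vol_insert finS v by blast
    show ?thesis
    proof (cases "vol (insert v S) \<le> b")
      case False
      hence "\<delta> S < deg S v" using volS' by (simp add: \<delta>_def)
      thus ?thesis using degV by simp
    next
      case True
      have "V - insert v S = V - S - {v}" by auto
      hence volY': "vol (V - insert v S) = vol (V - S) - 2 * deg (V - S) v"
        using vol_remove[of "V - S" v] fin v by simp
      have \<delta>': "\<delta> (insert v S) = \<delta> S - deg S v" using volS' by (simp add: \<delta>_def field_simps)
      \<comment> \<open>As \<open>v\<close> fits, only the second clause of \<open>good\<close> can
        fail for \<open>insert v S\<close>, while it holds for \<open>S\<close>.\<close>
      have "vol (V - S) + (K - 2) * (D - \<delta> S)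
          < vol (V - S) - 2 * deg (V - S) v + (K - 2) * (D - (\<delta> S - deg S v))"
        using max[OF v] True S(3) unfolding good_def volY' \<delta>' by linarith
      hence "2 * deg (V - S) v < (K - 2) * deg S v" by (simp add: algebra_simps)
      also have "\<dots> \<le> (K - 2) * (D - deg (V - S) v)"
        using degV K by (intro mult_left_mono) auto
      finally have "K * deg (V - S) v \<le> K * D - 2 * D" by (simp add: algebra_simps)
      also have "\<dots> \<le> K * (D - \<delta> S)" using K\<delta> D(1) by (simp add: algebra_simps)
      finally show ?thesis using K by simp
    qed
  qed
  ultimately show ?thesis using S unfolding good_def by blast
qed

section \<open>Colorings with light color classes\<close>

lemma bounded_coloring_exists:
  fixes b D :: real
  assumes "1 \<le> k" "finite V" "0 \<le> D" "\<And>v. v \<in> V \<Longrightarrow> deg V v \<le> D"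
    and "vol V + (real k - 1) * D \<le> (real k)\<^sup>2 * b"
  shows "\<exists>f. f ` V \<subseteq> {1..k} \<and> (\<forall>i\<in>{1..k}. vol {v \<in> V. f v = i} \<le> b)"
  using assms
proof (induction k arbitrary: V D rule: nat_induct_at_least)
  case base
  thus ?case by (intro exI[of _ "\<lambda>_. 1"]) auto
next
  case (Suc k)
  \<comment> \<open>\<open>K\<close> includes the color about to be split off, so
    \<open>K - 1\<close> and \<open>K - 2\<close> become \<open>k\<close> and \<open>k - 1\<close>
    for the rest.\<close>
  define K where "K = real (Suc k)"
  have K: "K \<ge> 2" using Suc.hyps by (simp add: K_def)
  have "0 \<le> K\<^sup>2 * b" using Suc.prems vol_nonneg[of V] K
    by (smt (verit) K_def mult_nonneg_nonneg)
  hence b: "0 \<le> b" using K by (simp add: zero_le_mult_iff)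
  obtain S0 where S0: "S0 \<subseteq> V"
    "\<And>v. v \<in> S0 \<Longrightarrow> (K - 1) * deg S0 v \<le> deg (V - S0) v"
    "\<And>v. v \<in> V - S0 \<Longrightarrow> deg (V - S0) v \<le> (K - 1) * deg S0 v"
    using locally_optimal_set_exists[OF \<open>finite V\<close>] by metis
  have "\<exists>S D'. S \<subseteq> V \<and> vol S \<le> b \<and> 0 \<le> D' \<and> (\<forall>v\<in>V - S. deg (V - S) v \<le> D') \<and>
    vol (V - S) + (K - 2) * D' \<le> (K - 1)\<^sup>2 * b"
  proof (cases "vol S0 \<le> b")
    case True
    show ?thesis
      by (rule split_off_from_light_set[of K V D b S0]) (use K Suc.prems S0 True in \<open>auto simp: K_def\<close>)
  next
    case False
    show ?thesis
      by (rule split_off_from_heavy_set[of K V D b S0]) (use K Suc.prems S0 False b in \<open>auto simp: K_def\<close>)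
  qed
  then obtain S D' where S: "S \<subseteq> V" "vol S \<le> b" and D': "0 \<le> D'"
      "\<And>v. v \<in> V - S \<Longrightarrow> deg (V - S) v \<le> D'"
      and rest: "vol (V - S) + (K - 2) * D' \<le> (K - 1)\<^sup>2 * b"
    by blast
  have "vol (V - S) + (real k - 1) * D' \<le> (real k)\<^sup>2 * b" using rest by (simp add: K_def)
  from Suc.IH[OF _ D' this] Suc.prems(1)
  obtain f where f: "f ` (V - S) \<subseteq> {1..k}"
      "\<And>i. i \<in> {1..k} \<Longrightarrow> vol {v \<in> V - S. f v = i} \<le> b"
    by auto
  have range: "1 \<le> f v" "f v \<le> k" if "v \<in> V" "v \<notin> S" for v
    using f(1) that by (auto simp: image_subset_iff)
  define h where "h v = (if v \<in> S then Suc k else f v)" for v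
  have "h ` V \<subseteq> {1..Suc k}" using range by (auto simp: h_def le_SucI)
  moreover have "vol {v \<in> V. h v = i} \<le> b" if "i \<in> {1..Suc k}" for i
  proof (cases "i = Suc k")
    case True
    hence "{v \<in> V. h v = i} = S" using S range(2) by (force simp: h_def split: if_splits)
    thus ?thesis using S by simp
  next
    case False
    hence "{v \<in> V. h v = i} = {v \<in> V - S. f v = i}" by (auto simp: h_def)
    thus ?thesis using f(2)[of i] that False by simp
  qed
  ultimately show ?case by blast
qed

lemma bounded_surjective_coloring_exists:
  assumes fin: "finite V" and card: "k \<le> card V" and b: "0 \<le> b"
    and ex: "\<exists>f. f ` V \<subseteq> {1..k} \<and> (\<forall>i\<in>{1..k}. vol {v \<in> V. f v = i} \<le> b)"
  shows "\<exists>f. f ` V = {1..k} \<and> (\<forall>i\<in>{1..k}. vol {v \<in> V. f v = i} \<le> b)"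
proof -
  define P where "P f \<longleftrightarrow> f ` V \<subseteq> {1..k} \<and> (\<forall>i\<in>{1..k}. vol {v \<in> V. f v = i} \<le> b)" for f
  obtain f0 where "P f0" using ex unfolding P_def by blast
  moreover have "\<forall>f. P f \<longrightarrow> card (f ` V) < Suc (card V)"
    by (simp add: card_image_le fin less_Suc_eq_le)
  ultimately have "\<exists>f. P f \<and> (\<forall>h. P h \<longrightarrow> card (h ` V) \<le> card (f ` V))"
    by (rule ex_has_greatest_nat)
  then obtain f where Pf: "P f" and max: "\<And>h. P h \<Longrightarrow> card (h ` V) \<le> card (f ` V)"
    by blast
  have f: "f ` V \<subseteq> {1..k}" "\<And>i. i \<in> {1..k} \<Longrightarrow> vol {v \<in> V. f v = i} \<le> b"
    using Pf by (simp_all add: P_def)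
  have "f ` V = {1..k}"
  proof (rule ccontr)
    assume neq: "f ` V \<noteq> {1..k}"
    then obtain j where j: "j \<in> {1..k}" "j \<notin> f ` V" using f(1) by blast
    have "card (f ` V) < card {1..k}" using neq f(1) by (intro psubset_card_mono) auto
    hence "\<not> inj_on f V" using card card_image[of f V] by auto
    then obtain u v where uv: "u \<in> V" "v \<in> V" "u \<noteq> v" "f u = f v" by (auto simp: inj_on_def)
    define h where "h = f(u := j)"
    have "vol {x \<in> V. h x = i} \<le> b" if i: "i \<in> {1..k}" for i
    proof (cases "i = j")
      case True
      have "{x \<in> V. h x = i} = {u}" using True j uv by (auto simp: h_def)
      thus ?thesis using b by (simp add: vol_def deg_def diag)
    next
      case False
      hence "vol {x \<in> V. h x = i} \<le> vol {x \<in> V. f x = i}"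
        using fin by (intro vol_mono) (auto simp: h_def)
      thus ?thesis using f(2)[OF i] by simp
    qed
    moreover have "h ` V \<subseteq> {1..k}" using f(1) j by (auto simp: h_def)
    ultimately have "P h" by (simp add: P_def)
    moreover have "insert j (f ` V) \<subseteq> h ` V"
    proof -
      have "f x \<in> h ` V" if "x \<in> V" for x
        using that uv image_eqI[of _ h v V] image_eqI[of _ h x V]
        by (cases "x = u") (simp_all add: h_def)
      moreover have "j \<in> h ` V" using uv image_eqI[of j h u V] by (simp add: h_def)
      ultimately show ?thesis by auto
    qed
    hence "card (f ` V) < card (h ` V)"
      using fin j card_mono[of "h ` V" "insert j (f ` V)"] by simp
    ultimately show False using max[of h] by simp
  qed
  thus ?thesis using f(2) by blast
qed

end

section \<open>Translation from weighted graphs\<close>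

context finite_weighted_graph
begin

text \<open>The value 0 off \<open>E\<close> turns neighborhood sums into sums over all of
  \<open>V\<close>. Since \<open>{v, v}\<close> is a singleton and edges have two elements, the
  diagonal vanishes.\<close>

definition edge_weight :: "'a \<Rightarrow> 'a \<Rightarrow> real" where
  "edge_weight u v = (if {u, v} \<in> E then w {u, v} else 0)"

sublocale symmetric_weight edge_weight
proof
  show "edge_weight u v = edge_weight v u" for u v by (simp add: edge_weight_def insert_commute)
  show "edge_weight v v = 0" for v using edges[of "{v}"] by (auto simp: edge_weight_def)
  show "0 \<le> edge_weight u v" for u v by (simp add: edge_weight_def weight_nonneg)
qed

text \<open>Induction on \<open>S\<close>: inserting \<open>x\<close> adds exactly the edges
  \<open>{x, u}\<close> with \<open>u\<close> in \<open>S\<close>, whose weight is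
  \<open>deg S x\<close>, in step with \<open>vol_insert\<close>.\<close>

lemma vol_eq_total_weight:
  assumes "finite S"
  shows "vol S = 2 * total_weight (induced_edges E S) w"
  using assms
proof (induction S)
  case empty
  have "induced_edges E {} = {}" using edges by (fastforce simp: induced_edges_def)
  thus ?case by (simp add: total_weight_def)
next
  case (insert x S)
  let ?N = "{u \<in> S. {x, u} \<in> E}"
  have split: "induced_edges E (insert x S) = induced_edges E S \<union> (\<lambda>u. {x, u}) ` ?N"
  proof (intro equalityI subsetI)
    fix e assume e: "e \<in> induced_edges E (insert x S)"
    hence "e \<in> E" "card e = 2" "e \<subseteq> insert x S" using edges by (auto simp: induced_edges_def)
    thus "e \<in> induced_edges E S \<union> (\<lambda>u. {x, u}) ` ?N"
    proof (cases "x \<in> e")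
      case True
      then obtain u where "e = {x, u}" "u \<noteq> x"
        using \<open>card e = 2\<close> by (auto simp: card_2_iff)
      thus ?thesis using \<open>e \<in> E\<close> \<open>e \<subseteq> insert x S\<close> by auto
    qed (auto simp: induced_edges_def)
  qed (auto simp: induced_edges_def)
  have "finite (induced_edges E S)"
    using insert.hyps by (auto simp: induced_edges_def intro: finite_subset[of _ "Pow S"])
  moreover have "inj_on (\<lambda>u. {x, u}) ?N" by (auto simp: inj_on_def doubleton_eq_iff)
  moreover have "induced_edges E S \<inter> (\<lambda>u. {x, u}) ` ?N = {}"
    using insert.hyps by (auto simp: induced_edges_def)
  ultimately have "total_weight (induced_edges E (insert x S)) w
      = total_weight (induced_edges E S) w + (\<Sum>u\<in>?N. w {x, u})"
    using insert.hyps by (simp add: total_weight_def split sum.union_disjoint sum.reindex)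
  moreover have "(\<Sum>u\<in>?N. w {x, u}) = deg S x"
    using insert.hyps by (simp add: deg_def edge_weight_def sum.If_cases Int_def)
  ultimately show ?case using insert vol_insert[of S x] by simp
qed

lemma deg_eq_weighted_degree: "deg V v = weighted_degree E w v"
proof -
  have "neighborhood E v = {u \<in> V. {v, u} \<in> E}" using edges by (auto simp: neighborhood_def)
  thus ?thesis
    using finite_vertices
    by (simp add: weighted_degree_def deg_def edge_weight_def sum.If_cases Int_def)
qed

end

theorem theorem6:
  fixes k :: nat and V :: "'a set" and E :: "'a set set" and w :: "'a set \<Rightarrow> real"
  assumes "k \<ge> 2"
    and "finite_weighted_graph V E w"
    and "card V \<ge> k"
  shows "\<exists>X. is_k_partition k V X \<and>
    Max ((\<lambda>i. total_weight (induced_edges E (X i)) w) ` {1..k})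
      \<le> total_weight E w / (real k)\<^sup>2
        + (real k - 1) / (2 * (real k)\<^sup>2) * max_weighted_degree V E w"
proof -
  interpret finite_weighted_graph V E w by fact
  define D where "D = max_weighted_degree V E w"
  define B where "B = total_weight E w / (real k)\<^sup>2 + (real k - 1) / (2 * (real k)\<^sup>2) * D"
  have "V \<noteq> {}" using assms by auto
  then obtain x where x: "x \<in> V" by blast
  have D: "deg V v \<le> D" if "v \<in> V" for v
    using that finite_vertices
    by (simp add: D_def max_weighted_degree_def deg_eq_weighted_degree)
  have D0: "0 \<le> D" using D[OF x] deg_nonneg[of V x] by linarith
  have "induced_edges E V = E" using edges by (auto simp: induced_edges_def)
  hence volV: "vol V = 2 * total_weight E w" using vol_eq_total_weight finite_vertices by simp
  \<comment> \<open>\<open>B\<close> is chosen so that the hypothesis of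
    \<open>bounded_coloring_exists\<close> holds with equality for \<open>b = 2 * B\<close>.\<close>
  have "(real k)\<^sup>2 * (2 * B) = vol V + (real k - 1) * D"
    using assms(1) by (simp add: B_def volV field_simps)
  moreover from this have B0: "0 \<le> 2 * B"
    using assms(1) D0 vol_nonneg[of V] unfolding B_def volV by simp
  ultimately obtain f where f: "f ` V = {1..k}"
      "\<And>i. i \<in> {1..k} \<Longrightarrow> vol {v \<in> V. f v = i} \<le> 2 * B"
    using bounded_coloring_exists[of k V D "2 * B"] D D0 finite_vertices assms
      bounded_surjective_coloring_exists[of V k "2 * B"] by auto
  define X where "X i = {v \<in> V. f v = i}" for i
  have "is_k_partition k V X"
    unfolding is_k_partition_def
  proof (intro conjI ballI)
    show "(\<Union>i\<in>{1..k}. X i) = V" using f(1) by (auto simp: X_def)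
    show "disjoint_family_on X {1..k}" by (auto simp: disjoint_family_on_def X_def)
    show "X i \<noteq> {}" if "i \<in> {1..k}" for i
    proof -
      have "i \<in> f ` V" using that by (simp only: f(1))
      thus ?thesis by (auto simp: X_def)
    qed
  qed
  moreover have "total_weight (induced_edges E (X i)) w \<le> B" if "i \<in> {1..k}" for i
    using f(2)[OF that] vol_eq_total_weight[of "X i"] finite_vertices by (simp add: X_def)
  hence "Max ((\<lambda>i. total_weight (induced_edges E (X i)) w) ` {1..k}) \<le> B"
    using assms(1) by (subst Max_le_iff) auto
  ultimately show ?thesis unfolding B_def D_def by blast
qed

end
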